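(* Assume that $V$ and $f$ are symmetric, i.e. $V(-x)=V(x)$ and $f(-x)=f(x)$ for all $x\in\mathbb{R}$, where $f\in L_0^2(\pi)$ is smooth and monotone (decreasing or increasing) on $(-\infty,0]$. Let $\phi\in L_0^2(\pi)$ solve $-(-V'\phi'+\phi'')=f$. Let $\xi(x,y)=\frac14\phi(x)\phi(y)$ and, for $\alpha\in\mathcal{A}$, let $\Gamma_\alpha=2\alpha(x,y)\partial_x\partial_y$ and $\delta\sigma_F^2(\Gamma_\alpha)=\int_{\mathbb{R}^2}\Gamma_\alpha\xi\,\mathrm{d}\bar\pi_0$. Then $$\alpha^*(x,y)=\begin{cases}1&\text{if }x\cdot y\le0,\\-1&\text{if }x\cdot y>0,\end{cases}$$ satisfies $\delta\sigma_F^2(\Gamma_{\alpha^*})\le\delta\sigma_F^2(\Gamma_\alpha)$ for all $\alpha\in\mathcal{A}$.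
   Context: $V\in C^\infty(\mathbb{R})$ with $Z=\int_{\mathbb{R}}e^{-V}\,\mathrm{d}x<\infty$, $\pi(\mathrm{d}x)=Z^{-1}e^{-V(x)}\mathrm{d}x$, $\bar\pi_0=\pi\otimes\pi$ on $\mathbb{R}^2$, $L_0^2(\pi)=\{f\in L^2(\pi):\pi(f)=0\}$. The overdamped Langevin generator is $\mathcal{L}=-V'\partial_x+\partial_x^2$; it is assumed invertible on $L_0^2(\pi)$, i.e. for every $f\in L_0^2(\pi)$ there is $\phi\in\mathcal{D}(\mathcal{L})\cap L_0^2(\pi)$ with $-\mathcal{L}\phi=f$; $\phi$ denotes this solution. $\mathcal{A}=\{\alpha:\mathbb{R}^2\to\mathbb{R}\ \text{measurable},\ -1\le\alpha\le1\}$. The functional $\delta\sigma_F^2$ is the first-order variation, at independent coupling, of the asymptotic variance for the observable $F(x,y)=\frac12(f(x)+f(y))$ of two coupled Langevin particles. *)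

theory Defs
  imports "HOL-Probability.Probability"
begin

definition smooth :: "(real \<Rightarrow> real) \<Rightarrow> bool" where
  "smooth u \<longleftrightarrow> (\<forall>n x. ((deriv ^^ n) u) differentiable (at x))"

definition partition_const :: "(real \<Rightarrow> real) \<Rightarrow> real" where
  "partition_const V = (\<integral>x. exp (- V x) \<partial>lborel)"

definition gibbs :: "(real \<Rightarrow> real) \<Rightarrow> real measure" where
  "gibbs V = density lborel (\<lambda>x. ennreal (exp (- V x) / partition_const V))"

definition indep_coupling :: "(real \<Rightarrow> real) \<Rightarrow> (real \<times> real) measure" where
  "indep_coupling V = gibbs V \<Otimes>\<^sub>M gibbs V"

text \<open>Elements of the \<open>L\<^sup>2\<close> spaces are represented by Borel functions.\<close>

definition L2 :: "'a measure \<Rightarrow> ('a \<Rightarrow> real) set" where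
  "L2 M = {g \<in> borel_measurable M. integrable M (\<lambda>x. (g x)\<^sup>2)}"

definition L2_0 :: "'a measure \<Rightarrow> ('a \<Rightarrow> real) set" where
  "L2_0 M = {g \<in> L2 M. (\<integral>x. g x \<partial>M) = 0}"

definition langevin :: "(real \<Rightarrow> real) \<Rightarrow> (real \<Rightarrow> real) \<Rightarrow> real \<Rightarrow> real" where
  "langevin V u x = - deriv V x * deriv u x + deriv (deriv u) x"

text \<open>
  The graph of the generator as an unbounded operator on \<open>L\<^sup>2\<close> of the Gibbs measure:
  the closure of \<open>langevin V\<close> on smooth compactly supported functions. On the real line
  these form a core of the generator of the Langevin semigroup whenever \<open>V\<close> is smooth.
\<close>

definition generator_graph :: "(real \<Rightarrow> real) \<Rightarrow> ((real \<Rightarrow> real) \<times> (real \<Rightarrow> real)) set" where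
  "generator_graph V = {(u, g). u \<in> L2 (gibbs V) \<and> g \<in> L2 (gibbs V) \<and>
     (\<exists>w :: nat \<Rightarrow> real \<Rightarrow> real.
        (\<forall>n. smooth (w n) \<and> compact (closure {x. w n x \<noteq> 0})) \<and>
        (\<lambda>n. \<integral>x. (w n x - u x)\<^sup>2 \<partial>gibbs V) \<longlonglongrightarrow> 0 \<and>
        (\<lambda>n. \<integral>x. (langevin V (w n) x - g x)\<^sup>2 \<partial>gibbs V) \<longlonglongrightarrow> 0)}"

definition generator_invertible :: "(real \<Rightarrow> real) \<Rightarrow> bool" where
  "generator_invertible V \<longleftrightarrow>
     (\<forall>g \<in> L2_0 (gibbs V). \<exists>u \<in> L2_0 (gibbs V). (u, \<lambda>x. - g x) \<in> generator_graph V)"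

definition admissible :: "(real \<times> real \<Rightarrow> real) set" where
  "admissible = {\<alpha> \<in> borel_measurable borel. \<forall>p. -1 \<le> \<alpha> p \<and> \<alpha> p \<le> 1}"

definition Gamma_op ::
    "(real \<times> real \<Rightarrow> real) \<Rightarrow> (real \<times> real \<Rightarrow> real) \<Rightarrow> real \<times> real \<Rightarrow> real" where
  "Gamma_op \<alpha> h = (\<lambda>(x, y). 2 * \<alpha> (x, y) * deriv (\<lambda>s. deriv (\<lambda>t. h (s, t)) y) x)"

definition xi :: "(real \<Rightarrow> real) \<Rightarrow> real \<times> real \<Rightarrow> real" where
  "xi \<phi> = (\<lambda>(x, y). 1 / 4 * \<phi> x * \<phi> y)"

text \<open>
  First-order variation of the asymptotic variance at the independent coupling, for the
  observable \<open>(f x + f y) / 2\<close>, in terms of the solution \<open>\<phi>\<close> of the Poisson equation for \<open>f\<close>.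
\<close>

definition delta_sigma2 ::
    "(real \<Rightarrow> real) \<Rightarrow> (real \<Rightarrow> real) \<Rightarrow>
     ((real \<times> real \<Rightarrow> real) \<Rightarrow> real \<times> real \<Rightarrow> real) \<Rightarrow> real" where
  "delta_sigma2 V \<phi> \<Gamma> = (\<integral>p. \<Gamma> (xi \<phi>) p \<partial>indep_coupling V)"

definition alpha_star :: "real \<times> real \<Rightarrow> real" where
  "alpha_star = (\<lambda>(x, y). if x * y \<le> 0 then 1 else -1)"

end

theory Submission imports Defs begin

text \<open>
  Since \<open>\<Gamma>\<^sub>\<alpha> \<xi> (x, y) = \<alpha>(x, y) \<phi>'(x) \<phi>'(y) / 2\<close>, the claim holds pointwise once \<open>\<phi>'(x) \<phi>'(y)\<close> has the sign
  of \<open>x y\<close>; integrability of \<open>\<phi>'\<close> is needed as well, because a divergent Bochner integral is \<open>0\<close>.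
  With \<open>w = e\<^sup>-\<^sup>V\<close>, the Poisson equation reads \<open>(w \<phi>')' = - w f\<close>.

  Let \<open>E(X)\<close> be the integral of \<open>w \<phi>'\<^sup>2\<close> over \<open>[0, X]\<close>. Integrating by parts, \<open>E \<le> \<bar>w \<phi> \<phi>'\<bar> + K\<close>, so an unbounded
  \<open>E\<close> would eventually satisfy \<open>E\<^sup>2 \<le> 4 (w \<phi>\<^sup>2) E'\<close>, which is impossible for integrable \<open>w \<phi>\<^sup>2\<close>.
  Hence \<open>\<phi>' \<in> L\<^sup>2(\<pi>)\<close>, and then the flux \<open>w \<phi>'\<close> cannot stay away from \<open>0\<close>, as \<open>w \<phi>'\<^sup>2 + w \<ge> 2 \<bar>w \<phi>'\<bar>\<close>.
  By symmetry \<open>w(x) (\<phi>'(x) + \<phi>'(-x))\<close> is constant, hence zero, so \<open>\<phi>'\<close> is odd. If, for \<open>f\<close>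
  decreasing on \<open>[0, \<infinity>)\<close>, the flux became positive at some \<open>x > 0\<close>, then \<open>f\<close> would be negative from
  there on and the flux would stay above its value at \<open>x\<close>.
\<close>

section \<open>Obstructions to growth on a half-line\<close>

text \<open>Integrating over \<open>{a..X}\<close> gives \<open>k * (X - a) \<le> C\<close> with
  \<open>C\<close> independent of \<open>X\<close>, since the integral of \<open>p\<close> and the
  increment of \<open>F\<close> are bounded above. Both contradictions at infinity below reduce to
  this.\<close>

lemma integrable_plus_bounded_derivative_not_bounded_below:
  fixes p F F' :: "real \<Rightarrow> real"
  assumes p: "integrable lborel p" "\<And>x. 0 \<le> p x"
    and F: "\<And>x. a \<le> x \<Longrightarrow> (F has_real_derivative F' x) (at x)"
    and bound: "\<And>x. a \<le> x \<Longrightarrow> F x \<le> B"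
    and below: "\<And>x. a \<le> x \<Longrightarrow> k \<le> p x + F' x"
  shows "k \<le> 0"
proof (rule ccontr)
  assume "\<not> k \<le> 0"
  then have k: "k > 0" by simp
  define C where "C = integral UNIV p + B - F a"
  have est: "k * (X - a) \<le> C" if X: "a \<le> X" for X
  proof -
    have pU: "p integrable_on UNIV"
      using p(1) by (rule integrable_on_lborel)
    then have pI: "p integrable_on {a..X}"
      by (rule integrable_on_subinterval) simp
    have hF: "(F' has_integral (F X - F a)) {a..X}"
      using X F by (intro fundamental_theorem_of_calculus)
        (auto simp: has_real_derivative_iff_has_vector_derivative[symmetric]
              intro: has_field_derivative_at_within)
    have sum: "((\<lambda>x. p x + F' x) has_integral (integral {a..X} p + (F X - F a))) {a..X}"
      by (intro has_integral_add integrable_integral pI hF)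
    have const: "((\<lambda>_. k) has_integral (k * (X - a))) {a..X}"
      using has_integral_const_real[of k a X] X by (simp add: mult.commute)
    have "k * (X - a) \<le> integral {a..X} p + (F X - F a)"
      by (rule has_integral_le[OF const sum]) (use below in auto)
    moreover have "integral {a..X} p \<le> integral UNIV p"
      by (intro integral_subset_le pI pU) (use p(2) in auto)
    ultimately show ?thesis
      using bound[OF X] by (simp add: C_def)
  qed
  \<comment> \<open>This endpoint turns the left side into \<open>\<bar>C\<bar> + 1\<close>, which
    exceeds \<open>C\<close>.\<close>
  have "k * (a + (\<bar>C\<bar> + 1) / k - a) \<le> C"
    using k by (intro est) auto
  then show False
    using k by simp
qed

text \<open>A nondecreasing function bounded above converges at infinity, so the integral of its
  derivative is finite.\<close>

lemma integrable_if_antiderivative_bounded: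
  fixes p F :: "real \<Rightarrow> real"
  assumes [measurable]: "p \<in> borel_measurable borel" and nonneg: "\<And>x. 0 \<le> p x"
    and F: "\<And>x. a \<le> x \<Longrightarrow> (F has_real_derivative p x) (at x)"
    and bound: "\<And>x. a \<le> x \<Longrightarrow> F x \<le> B"
  shows "set_integrable lborel {a..} p"
proof -
  \<comment> \<open>Freezing \<open>F\<close> to the left of \<open>a\<close> makes it monotone on
    the whole line, so its limit along the naturals is its limit at infinity.\<close>
  define G where "G x = F (max a x)" for x
  have monoF: "F x \<le> F y" if "a \<le> x" "x \<le> y" for x y
    using that F nonneg by (intro DERIV_nonneg_imp_nondecreasing[of x y F]) (auto intro: order_trans)
  have monoG: "mono G"
    by (intro monoI) (auto simp: G_def intro!: monoF)
  have "(\<lambda>n. G (real n)) \<longlonglongrightarrow> (SUP n. G (real n))"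
    by (intro LIMSEQ_incseq_SUP)
       (auto simp: G_def incseq_def intro!: bdd_aboveI[of _ B] bound monoF)
  then have "(G \<longlongrightarrow> (SUP n. G (real n))) at_top"
    using monoG by (intro tendsto_at_topI_sequentially_real)
  moreover have "eventually (\<lambda>x. G x = F x) at_top"
    using eventually_ge_at_top[of a] by eventually_elim (simp add: G_def max_def)
  ultimately have lim: "(F \<longlongrightarrow> (SUP n. G (real n))) at_top"
    by (simp add: filterlim_cong)
  have "(\<integral>\<^sup>+x. ennreal (p x) * indicator {a..} x \<partial>lborel) = (SUP n. G (real n)) - F a"
    by (intro nn_integral_FTC_atLeast F nonneg lim) auto
  moreover have "ennreal (norm (indicator {a..} x *\<^sub>R p x)) = ennreal (p x) * indicator {a..} x" for x
    using nonneg[of x] by (auto simp: indicator_def)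
  ultimately show ?thesis
    unfolding set_integrable_def by (simp add: integrable_iff_bounded)
qed

text \<open>
  The hypothesis \<open>E\<^sup>2 \<le> C p E'\<close> makes \<open>p + C E' / E\<^sup>2\<close> bounded below by AM-GM,
  while \<open>E' / E\<^sup>2\<close> is the derivative of the bounded function \<open>- 1 / E\<close>.
\<close>

lemma square_not_le_integrable_times_derivative:
  fixes p E E' :: "real \<Rightarrow> real"
  assumes p: "integrable lborel p" "\<And>x. 0 \<le> p x"
    and E: "\<And>x. a \<le> x \<Longrightarrow> (E has_real_derivative E' x) (at x)"
    and pos: "\<And>x. a \<le> x \<Longrightarrow> 0 < E x" and E': "\<And>x. a \<le> x \<Longrightarrow> 0 \<le> E' x"
    and C: "0 < C" and le: "\<And>x. a \<le> x \<Longrightarrow> (E x)\<^sup>2 \<le> C * p x * E' x"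
  shows False
proof -
  have "2 \<le> (0::real)"
  proof (rule integrable_plus_bounded_derivative_not_bounded_below
        [of "\<lambda>x. C * p x" a "\<lambda>x. - 1 / E x" "\<lambda>x. E' x / (E x)\<^sup>2" 0])
    fix x assume x: "a \<le> x"
    show "((\<lambda>x. - 1 / E x) has_real_derivative E' x / (E x)\<^sup>2) (at x)"
      using pos[OF x] by (auto intro!: derivative_eq_intros E x simp: power2_eq_square)
    define t where "t = E' x / (E x)\<^sup>2"
    have "0 \<le> t" using E'[OF x] by (simp add: t_def)
    have "1 \<le> C * p x * t"
      using le[OF x] pos[OF x] by (simp add: t_def field_simps)
    moreover have "0 \<le> C * p x" using C p(2) by simp
    moreover have "4 * (C * p x * t) \<le> (C * p x + t)\<^sup>2"
      using zero_le_power2[of "C * p x - t"] by (simp add: power2_eq_square algebra_simps)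
    ultimately have "2\<^sup>2 \<le> (C * p x + t)\<^sup>2" by simp
    then show "2 \<le> C * p x + E' x / (E x)\<^sup>2"
      using \<open>0 \<le> t\<close> \<open>0 \<le> C * p x\<close> power2_le_imp_le[of 2 "C * p x + t"] by (simp add: t_def)
  qed (use p C pos in \<open>auto simp: less_imp_le\<close>)
  then show False by simp
qed

text \<open>It settles both the parity of \<open>\<phi>'\<close> and its sign. The points
  \<open>a\<close> and \<open>b\<close> differ because the energy is controlled from
  \<open>0\<close> on, while the flux may be bounded below only further out.\<close>

lemma weighted_flux_not_bounded_away:
  fixes w u :: "real \<Rightarrow> real"
  assumes w: "integrable lborel w" "\<And>x. 0 < w x"
    and u: "set_integrable lborel {b..} (\<lambda>x. w x * (u x)\<^sup>2)" and "b \<le> a"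
    and c: "\<And>x. a \<le> x \<Longrightarrow> c \<le> \<bar>w x * u x\<bar>"
  shows "c \<le> 0"
proof -
  have "2 * c \<le> 0"
  proof (rule integrable_plus_bounded_derivative_not_bounded_below
        [of "\<lambda>x. w x + indicator {b..} x * (w x * (u x)\<^sup>2)" a "\<lambda>_. 0" "\<lambda>_. 0" 0])
    show "integrable lborel (\<lambda>x. w x + indicator {b..} x * (w x * (u x)\<^sup>2))"
      using u by (intro Bochner_Integration.integrable_add w) (simp add: set_integrable_def)
    fix x
    show "0 \<le> w x + indicator {b..} x * (w x * (u x)\<^sup>2)"
      using w(2)[of x] by (simp add: indicator_def)
    assume x: "a \<le> x"
    have "0 \<le> w x * (\<bar>u x\<bar> - 1)\<^sup>2"
      using w(2)[of x] by simp
    also have "\<dots> = w x * (u x)\<^sup>2 + w x - 2 * \<bar>w x * u x\<bar>"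
      using w(2)[of x] by (simp add: power2_diff abs_mult algebra_simps)
    finally show "2 * c \<le> w x + indicator {b..} x * (w x * (u x)\<^sup>2) + 0"
      using c[OF x] x \<open>b \<le> a\<close> by (simp add: indicator_def)
  qed auto
  then show ?thesis by simp
qed

section \<open>Finite Dirichlet energy\<close>

text \<open>No decay of the boundary term \<open>w * \<phi> * u\<close> is known in advance, so
  integration by parts cannot simply discard it; it yields a differential inequality for the energy
  instead. No parity enters, so the estimate serves the solution and its reflection alike.\<close>

lemma dirichlet_energy_half_line:
  fixes w u f \<phi> :: "real \<Rightarrow> real"
  assumes w: "\<And>x. 0 < w x" "continuous_on UNIV w"
    and \<phi>: "\<And>x. (\<phi> has_real_derivative u x) (at x)"
    and wu: "\<And>x. ((\<lambda>x. w x * u x) has_real_derivative - (w x * f x)) (at x)"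
    and u: "continuous_on UNIV u" and f: "continuous_on UNIV f"
    and \<phi>2: "integrable lborel (\<lambda>x. w x * (\<phi> x)\<^sup>2)"
    and f2: "integrable lborel (\<lambda>x. w x * (f x)\<^sup>2)"
  shows "set_integrable lborel {0..} (\<lambda>x. w x * (u x)\<^sup>2)"
proof -
  have cont\<phi>: "continuous_on UNIV \<phi>"
    using \<phi> by (auto intro!: continuous_at_imp_continuous_on DERIV_isCont)
  have [measurable]: "w \<in> borel_measurable borel" "u \<in> borel_measurable borel"
    "\<phi> \<in> borel_measurable borel" "f \<in> borel_measurable borel"
    using w(2) u f cont\<phi> by (auto intro: borel_measurable_continuous_onI)
  define g where "g x = w x * (u x)\<^sup>2" for x
  define h where "h x = w x * \<phi> x * f x" for x
  define D where "D x = \<phi> x * (w x * u x)" for x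
  define E where "E x = integral {0..x} g" for x
  have contg: "continuous_on UNIV g"
    unfolding g_def by (intro continuous_intros w u)
  have conth: "continuous_on UNIV h"
    unfolding h_def by (intro continuous_intros w f cont\<phi>)
  have g0: "0 \<le> g x" for x
    using w(1)[of x] by (simp add: g_def)
  have DE: "(E has_real_derivative g x) (at x)" if "0 < x" for x
  proof -
    have "(E has_real_derivative g x) (at x within {0..x+1})"
      unfolding E_def using that
      by (intro integral_has_real_derivative continuous_on_subset[OF contg]) auto
    then show ?thesis
      using that by (simp add: at_within_Icc_at)
  qed
  define H where "H = integral UNIV (\<lambda>x. \<bar>h x\<bar>)"
  have habs: "integrable lborel (\<lambda>x. \<bar>h x\<bar>)"
  proof (rule Bochner_Integration.integrable_bound
      [OF Bochner_Integration.integrable_add[OF \<phi>2 f2]])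
    show "(\<lambda>x. \<bar>h x\<bar>) \<in> borel_measurable lborel"
      unfolding h_def by measurable
    have "\<bar>h x\<bar> \<le> w x * (\<phi> x)\<^sup>2 + w x * (f x)\<^sup>2" for x
    proof -
      have "\<bar>\<phi> x\<bar> * \<bar>f x\<bar> \<le> (\<phi> x)\<^sup>2 + (f x)\<^sup>2"
        using zero_le_power2[of "\<bar>\<phi> x\<bar> - \<bar>f x\<bar>"] mult_nonneg_nonneg[of "\<bar>\<phi> x\<bar>" "\<bar>f x\<bar>"]
        unfolding power2_diff mult.assoc power2_abs by linarith
      from mult_left_mono[OF this less_imp_le[OF w(1)[of x]]] show ?thesis
        using w(1)[of x] by (simp add: h_def abs_mult algebra_simps)
    qed
    then show "AE x in lborel. norm \<bar>h x\<bar> \<le> norm (w x * (\<phi> x)\<^sup>2 + w x * (f x)\<^sup>2)"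
      by (auto intro: order_trans[OF _ abs_ge_self])
  qed
  define K where "K = H + \<bar>D 0\<bar>"
  \<comment> \<open>\<open>D\<close> has derivative \<open>g - h\<close>, so the energy differs from
    \<open>D X\<close> only by \<open>D 0\<close> and an integral of \<open>h\<close>, both absorbed
    in \<open>K\<close>.\<close>
  have E_le: "E X \<le> \<bar>D X\<bar> + K" if X: "0 \<le> X" for X
  proof -
    have "((\<lambda>x. g x - h x) has_integral (D X - D 0)) {0..X}"
    proof (rule fundamental_theorem_of_calculus[OF X])
      fix x assume "x \<in> {0..X}"
      have "(D has_real_derivative (u x * (w x * u x) + - (w x * f x) * \<phi> x)) (at x)"
        unfolding D_def by (rule DERIV_mult[OF \<phi> wu])
      then have "(D has_real_derivative (g x - h x)) (at x)"
        by (simp add: g_def h_def power2_eq_square algebra_simps)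
      then show "(D has_vector_derivative (g x - h x)) (at x within {0..X})"
        by (auto simp: has_real_derivative_iff_has_vector_derivative[symmetric]
                 intro: has_field_derivative_at_within)
    qed
    moreover have hI: "h integrable_on {0..X}"
      by (intro integrable_continuous_real continuous_on_subset[OF conth]) simp
    ultimately have "(g has_integral (D X - D 0 + integral {0..X} h)) {0..X}"
      using has_integral_add[of "\<lambda>x. g x - h x" _ "{0..X}" h] by (simp add: has_integral_iff)
    then have "E X = D X - D 0 + integral {0..X} h"
      unfolding E_def by (rule integral_unique)
    moreover have "integral {0..X} h \<le> H"
    proof -
      have i1: "(\<lambda>x. \<bar>h x\<bar>) integrable_on UNIV"
        by (rule integrable_on_lborel[OF habs])
      then have i2: "(\<lambda>x. \<bar>h x\<bar>) integrable_on {0..X}"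
        by (rule integrable_on_subinterval) simp
      have "integral {0..X} h \<le> integral {0..X} (\<lambda>x. \<bar>h x\<bar>)"
        by (intro integral_le hI i2) auto
      also have "\<dots> \<le> H"
        unfolding H_def by (intro integral_subset_le i1 i2) auto
      finally show ?thesis .
    qed
    ultimately show ?thesis
      by (simp add: K_def)
  qed
  have K0: "0 \<le> K"
    using integral_nonneg[OF integrable_on_lborel[OF habs]] by (simp add: K_def H_def)
  have E_mono: "E x \<le> E y" if "0 < x" "x \<le> y" for x y
    using that(2)
  proof (rule DERIV_nonneg_imp_nondecreasing)
    fix t assume "x \<le> t" "t \<le> y"
    with that(1) show "\<exists>d. DERIV E t :> d \<and> 0 \<le> d"
      using DE[of t] g0 by auto
  qed
  \<comment> \<open>Above this threshold \<open>K\<close> is less than half of \<open>E\<close>, so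
    \<open>E \<le> 2 * \<bar>D\<bar>\<close>; since
    \<open>D\<^sup>2 = w * \<phi>\<^sup>2 * g\<close>, squaring produces the constant
    \<open>4\<close>.\<close>
  have E_bound: "E X \<le> 2 * K + 1" if X: "0 < X" for X
  proof (rule ccontr)
    assume "\<not> E X \<le> 2 * K + 1"
    then have big: "2 * K + 1 < E x" if "X \<le> x" for x
      using E_mono[OF X that] by simp
    show False
    proof (rule square_not_le_integrable_times_derivative[of "\<lambda>x. w x * (\<phi> x)\<^sup>2" X E g 4])
      fix x assume x: "X \<le> x"
      have "E x \<le> 2 * \<bar>D x\<bar>"
        using E_le[of x] big[OF x] X x by simp
      moreover have "0 \<le> E x"
        using big[OF x] K0 by simp
      ultimately have "(E x)\<^sup>2 \<le> (2 * \<bar>D x\<bar>)\<^sup>2"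
        by (intro power_mono)
      also have "\<dots> = 4 * (w x * (\<phi> x)\<^sup>2) * g x"
        by (simp add: D_def g_def power2_eq_square algebra_simps)
      finally show "(E x)\<^sup>2 \<le> 4 * (w x * (\<phi> x)\<^sup>2) * g x" .
      show "0 < E x" using big[OF x] K0 by simp
    qed (use X \<phi>2 DE g0 w(1) in \<open>auto simp: less_imp_le\<close>)
  qed
  \<comment> \<open>The derivative of \<open>E\<close> was obtained only at positive points, so the
    criterion starts from \<open>1\<close>; continuity of \<open>g\<close> covers
    \<open>{0..1}\<close>.\<close>
  have "set_integrable lborel {1..} g"
    by (rule integrable_if_antiderivative_bounded[of g 1 E "2 * K + 1"])
       (use DE E_bound g0 contg in \<open>auto intro: borel_measurable_continuous_onI\<close>)
  moreover have "set_integrable lborel {0..1} g"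
    by (intro borel_integrable_atLeastAtMost') (auto intro: continuous_on_subset[OF contg])
  ultimately have "set_integrable lborel ({0..1} \<union> {1..}) g"
    by (intro set_integrable_Un) auto
  also have "{0..1} \<union> {1..} = {0::real..}"
    by auto
  finally show ?thesis
    by (simp add: g_def[abs_def])
qed

section \<open>Sign of the flux for a monotone source\<close>

lemma flux_nonpos_if_source_antimono:
  fixes w u f :: "real \<Rightarrow> real"
  assumes w: "\<And>x. 0 < w x" "integrable lborel w"
    and wu: "\<And>x. ((\<lambda>x. w x * u x) has_real_derivative - (w x * f x)) (at x)"
    and energy: "set_integrable lborel {0..} (\<lambda>x. w x * (u x)\<^sup>2)"
    and u0: "u 0 = 0" and f: "antimono_on {0..} f" and x: "0 \<le> x"
  shows "u x \<le> 0"
proof (rule ccontr)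
  assume "\<not> u x \<le> 0"
  then have ux: "u x > 0" and "0 < x"
    using x u0 by (auto simp: less_le)
  define g where "g x = w x * u x" for x
  have g: "(g has_real_derivative - (w x * f x)) (at x)" for x
    unfolding g_def by (rule wu)
  \<comment> \<open>A flux that is \<open>0\<close> at \<open>0\<close> and positive at
    \<open>x\<close> has positive slope at some \<open>z\<close> in between, where the source is
    therefore negative.\<close>
  obtain z where z: "0 < z" "z < x" "g x - g 0 = (x - 0) * - (w z * f z)"
    using MVT2[OF \<open>0 < x\<close>, of g "\<lambda>x. - (w x * f x)"] g by blast
  have gx: "0 < g x"
    using ux w(1)[of x] by (simp add: g_def)
  have "f z < 0"
    using z gx u0 \<open>0 < x\<close> w(1)[of z]
    by (simp add: g_def[of 0] mult_less_0_iff zero_less_mult_iff)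
  then have f_neg: "f y \<le> 0" if "x \<le> y" for y
    using monotone_onD[OF f, of z y] z that by simp
  have grow: "g x \<le> g y" if "x \<le> y" for y
  proof (rule DERIV_nonneg_imp_nondecreasing[OF that])
    fix t assume "x \<le> t" "t \<le> y"
    then have "0 \<le> - (w t * f t)"
      using f_neg w(1)[of t] by (simp add: mult_le_0_iff)
    then show "\<exists>d. DERIV g t :> d \<and> 0 \<le> d"
      using g by blast
  qed
  have "g x \<le> 0"
    by (rule weighted_flux_not_bounded_away[OF w(2,1) energy x])
       (use grow in \<open>auto simp: g_def[symmetric] intro: order_trans[OF _ abs_ge_self]\<close>)
  then show False
    using gx by simp
qed

section \<open>Integrability: symmetry, products, Gibbs weight\<close>

lemma integrable_if_even_half_line:
  fixes q :: "real \<Rightarrow> real"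
  assumes half: "set_integrable lborel {0..} q" and even: "\<And>x. q (- x) = q x"
  shows "integrable lborel q"
proof -
  have "integrable lborel (\<lambda>x. indicator {0..} (0 + (-1) * x) *\<^sub>R q (0 + (-1) * x))"
    using half unfolding set_integrable_def by (intro lborel_integrable_real_affine) auto
  also have "(\<lambda>x. indicator {0..} (0 + (-1) * x) *\<^sub>R q (0 + (-1) * x)) = (\<lambda>x. indicator {..0} x *\<^sub>R q x)"
    by (auto simp: fun_eq_iff indicator_def even)
  finally have "set_integrable lborel {..0} q"
    by (simp add: set_integrable_def)
  from set_integrable_Un[OF this half] have "set_integrable lborel ({..0} \<union> {0..}) q"
    by simp
  also have "{..0} \<union> {0..} = (UNIV :: real set)"
    by auto
  finally show ?thesis
    by (simp add: set_integrable_def)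
qed

lemma integrable_pair_mult:
  fixes u v :: "_ \<Rightarrow> real"
  assumes "sigma_finite_measure M" "sigma_finite_measure N"
    and u: "integrable M u" and v: "integrable N v"
  shows "integrable (M \<Otimes>\<^sub>M N) (\<lambda>(x, y). u x * v y)"
proof -
  interpret M: sigma_finite_measure M by fact
  interpret N: sigma_finite_measure N by fact
  interpret pair_sigma_finite M N ..
  have [measurable]: "u \<in> borel_measurable M" "v \<in> borel_measurable N"
    using u v by auto
  show ?thesis
  proof (rule Fubini_integrable)
    show "integrable M (\<lambda>x. \<integral>y. norm (case (x, y) of (x, y) \<Rightarrow> u x * v y) \<partial>N)"
      using u by (simp add: abs_mult)
    show "AE x in M. integrable N (\<lambda>y. case (x, y) of (x, y) \<Rightarrow> u x * v y)"
      using v by simp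
  qed measurable
qed

text \<open>The normalisation is harmless because \<open>partition_const V\<close> is positive: an
  integrable, everywhere positive function has nonzero integral.\<close>

lemma integrable_gibbs_iff:
  assumes V: "continuous_on UNIV V" and int: "integrable lborel (\<lambda>x. exp (- V x))"
    and [measurable]: "g \<in> borel_measurable borel"
  shows "integrable (gibbs V) g \<longleftrightarrow> integrable lborel (\<lambda>x. exp (- V x) * g x)"
proof -
  have [measurable]: "V \<in> borel_measurable borel"
    by (rule borel_measurable_continuous_onI[OF V])
  have Z0: "0 \<le> partition_const V"
    unfolding partition_const_def by (intro integral_nonneg_AE) auto
  have "partition_const V \<noteq> 0"
  proof
    assume "partition_const V = 0"
    then have "AE x in lborel. exp (- V x) = 0"
      unfolding partition_const_def using int by (subst (asm) integral_nonneg_eq_0_iff_AE) auto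
    then have "AE x in (lborel :: real measure). False"
      by simp
    then show False
      by (simp add: AE_iff_null null_sets_def)
  qed
  then have Z: "0 < partition_const V"
    using Z0 by simp
  have "integrable (gibbs V) g \<longleftrightarrow>
      integrable lborel (\<lambda>x. (exp (- V x) / partition_const V) *\<^sub>R g x)"
    unfolding gibbs_def using Z by (intro integrable_density) auto
  also have "\<dots> \<longleftrightarrow> integrable lborel (\<lambda>x. inverse (partition_const V) * (exp (- V x) * g x))"
    by (simp add: divide_inverse mult_ac)
  also have "\<dots> \<longleftrightarrow> integrable lborel (\<lambda>x. exp (- V x) * g x)"
    using Z by simp
  finally show ?thesis .
qed

section \<open>The coupling operator and admissible controls\<close>

text \<open>The mixed derivative of a product of one-variable functions factorises; the coefficients
  \<open>2\<close> and \<open>1 / 4\<close> combine to \<open>1 / 2\<close>.\<close>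

lemma Gamma_op_xi:
  assumes "\<And>x. \<phi> differentiable (at x)"
  shows "Gamma_op \<alpha> (xi \<phi>) (x, y) = 1 / 2 * \<alpha> (x, y) * (deriv \<phi> x * deriv \<phi> y)"
proof -
  have D: "(\<phi> has_real_derivative deriv \<phi> x) (at x)" for x
    using assms[of x] DERIV_deriv_iff_real_differentiable by blast
  have "deriv (\<lambda>t. 1 / 4 * \<phi> s * \<phi> t) y = 1 / 4 * \<phi> s * deriv \<phi> y" for s
    by (intro DERIV_imp_deriv DERIV_cmult D)
  moreover have "deriv (\<lambda>s. 1 / 4 * \<phi> s * deriv \<phi> y) x = 1 / 4 * deriv \<phi> x * deriv \<phi> y"
    by (intro DERIV_imp_deriv DERIV_cmult_right DERIV_cmult D)
  ultimately have "deriv (\<lambda>s. deriv (\<lambda>t. 1 / 4 * \<phi> s * \<phi> t) y) x = 1 / 4 * deriv \<phi> x * deriv \<phi> y"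
    by (simp only:)
  then show ?thesis
    unfolding Gamma_op_def xi_def prod.case by simp
qed

lemma admissible_bounds:
  assumes "\<alpha> \<in> admissible"
  shows "-1 \<le> \<alpha> p" "\<alpha> p \<le> 1"
  using assms unfolding admissible_def by blast+

lemma alpha_star_admissible: "alpha_star \<in> admissible"
proof -
  have [measurable]: "alpha_star \<in> borel_measurable (borel \<Otimes>\<^sub>M borel)"
    unfolding alpha_star_def by measurable
  then show ?thesis
    by (auto simp: admissible_def borel_prod alpha_star_def split: prod.split)
qed

section \<open>Parity and sign of \<open>\<phi>'\<close>, and optimality\<close>

theorem corollary58:
  fixes V f \<phi> :: "real \<Rightarrow> real"
  assumes "smooth V"
    and "integrable lborel (\<lambda>x. exp (- V x))"
    and "generator_invertible V"
    and "\<forall>x. V (- x) = V x"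
    and "\<forall>x. f (- x) = f x"
    and "f \<in> L2_0 (gibbs V)"
    and "smooth f"
    and "antimono_on {..0} f \<or> mono_on {..0} f"
    and "\<phi> \<in> L2_0 (gibbs V)"
    and "\<forall>x. \<phi> differentiable (at x) \<and> deriv \<phi> differentiable (at x)"
    and "\<forall>x. - langevin V \<phi> x = f x"
  shows "\<forall>\<alpha> \<in> admissible. delta_sigma2 V \<phi> (Gamma_op alpha_star) \<le> delta_sigma2 V \<phi> (Gamma_op \<alpha>)"
proof -
  define w where "w x = exp (- V x)" for x
  define u where "u = deriv \<phi>"
  \<comment> \<open>\<open>v\<close> is the derivative of the reflected solution
    \<open>\<phi> (- x)\<close>; as \<open>V\<close> and \<open>f\<close> are even, it obeys the
    same flux equation as \<open>u\<close>.\<close>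
  define v where "v x = - u (- x)" for x
  have diffV: "V differentiable (at x)" and difff: "f differentiable (at x)" for x
    using assms(1,7)[unfolded smooth_def, rule_format, of 0 x] by auto
  have D\<phi>: "(\<phi> has_real_derivative u x) (at x)" for x
    using assms(10) DERIV_deriv_iff_real_differentiable unfolding u_def by blast
  have Du: "(u has_real_derivative deriv u x) (at x)" for x
    using assms(10) DERIV_deriv_iff_real_differentiable unfolding u_def by blast
  have DV: "(V has_real_derivative deriv V x) (at x)" for x
    using diffV DERIV_deriv_iff_real_differentiable by blast
  have contV: "continuous_on UNIV V" and contf: "continuous_on UNIV f"
    using diffV difff by (auto intro!: continuous_at_imp_continuous_on differentiable_imp_continuous_within)
  have contu: "continuous_on UNIV u" and cont\<phi>: "continuous_on UNIV \<phi>"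
    using Du D\<phi> by (auto intro!: continuous_at_imp_continuous_on DERIV_isCont)
  have contw: "continuous_on UNIV w"
    unfolding w_def by (intro continuous_intros contV)
  have [measurable]: "w \<in> borel_measurable borel" "u \<in> borel_measurable borel"
    "\<phi> \<in> borel_measurable borel" "f \<in> borel_measurable borel" "v \<in> borel_measurable borel"
    using contw contu contf cont\<phi> unfolding v_def[abs_def]
    by (auto intro!: borel_measurable_continuous_onI continuous_intros
      continuous_on_compose2[OF contu])
  have w0: "0 < w x" and w_even: "w (- x) = w x" for x
    using assms(4) by (auto simp: w_def)
  have f_even: "f (- x) = f x" for x
    using assms(5) by simp
  have w_int: "integrable lborel w"
    using assms(2) by (simp add: w_def[abs_def])
  note gibbs_iff = integrable_gibbs_iff[OF contV assms(2), folded w_def]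
  have \<phi>2: "integrable lborel (\<lambda>x. w x * (\<phi> x)\<^sup>2)"
    using assms(9) gibbs_iff[of "\<lambda>x. (\<phi> x)\<^sup>2"] by (simp add: L2_0_def L2_def)
  have f2: "integrable lborel (\<lambda>x. w x * (f x)\<^sup>2)"
    using assms(6) gibbs_iff[of "\<lambda>x. (f x)\<^sup>2"] by (simp add: L2_0_def L2_def)
  have wu: "((\<lambda>x. w x * u x) has_real_derivative - (w x * f x)) (at x)" for x
  proof -
    have "f x = deriv V x * u x - deriv u x"
      using assms(11)[rule_format, of x] by (simp add: langevin_def u_def)
    then show ?thesis
      unfolding w_def
      by (auto intro!: derivative_eq_intros DV Du simp: \<open>f x = _\<close> algebra_simps)
  qed
  have wv: "((\<lambda>x. w x * v x) has_real_derivative - (w x * f x)) (at x)" for x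
  proof -
    have "((\<lambda>x. w (- x) * u (- x)) has_real_derivative - (- (w (- x) * f (- x)))) (at x)"
      by (rule DERIV_mirror[THEN iffD1, OF wu])
    from DERIV_minus[OF this] show ?thesis
      by (simp add: v_def w_even f_even)
  qed
  have energy_u: "set_integrable lborel {0..} (\<lambda>x. w x * (u x)\<^sup>2)"
    by (intro dirichlet_energy_half_line[OF w0 contw D\<phi> wu contu contf \<phi>2 f2])
  \<comment> \<open>This is the energy of \<open>u\<close> on the negative half-line.\<close>
  have energy_v: "set_integrable lborel {0..} (\<lambda>x. w x * (v x)\<^sup>2)"
  proof (rule dirichlet_energy_half_line[OF w0 contw _ wv _ contf _ f2])
    show "((\<lambda>x. \<phi> (- x)) has_real_derivative v x) (at x)" for x
      unfolding v_def by (rule DERIV_mirror[THEN iffD1, OF D\<phi>])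
    show "continuous_on UNIV v"
      unfolding v_def[abs_def] by (auto intro!: continuous_intros continuous_on_compose2[OF contu])
    show "integrable lborel (\<lambda>x. w x * (\<phi> (- x))\<^sup>2)"
      using lborel_integrable_real_affine[OF \<phi>2, of "-1" 0] by (simp add: w_even)
  qed

  have flux_const: "w x * (u x - v x) = w 0 * (u 0 - v 0)" for x
    by (rule DERIV_isconst_all[of "\<lambda>x. w x * (u x - v x)"], rule allI)
       (use DERIV_diff[OF wu wv] in \<open>simp add: algebra_simps\<close>)
  \<comment> \<open>The energy of \<open>u - v\<close> is at most twice the sum of the two energies,
    hence finite, and a constant flux of finite energy vanishes.\<close>
  have "\<bar>w 0 * (u 0 - v 0)\<bar> \<le> 0"
  proof (rule weighted_flux_not_bounded_away[OF w_int w0 _ order_refl])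
    show "set_integrable lborel {0..} (\<lambda>x. w x * (u x - v x)\<^sup>2)"
    proof (rule set_integrable_bound[OF
          set_integral_add(1)[OF set_integrable_mult_right[of "2 :: real", OF energy_u]
            set_integrable_mult_right[of "2 :: real", OF energy_v]]])
      have "(u x - v x)\<^sup>2 \<le> 2 * (u x)\<^sup>2 + 2 * (v x)\<^sup>2" for x
        using zero_le_power2[of "u x + v x"] by (simp add: power2_diff power2_sum)
      from mult_left_mono[OF this less_imp_le[OF w0]]
      show "AE x in lborel. x \<in> {0..} \<longrightarrow> norm (w x * (u x - v x)\<^sup>2)
          \<le> norm (2 * (w x * (u x)\<^sup>2) + 2 * (w x * (v x)\<^sup>2))"
        using w0 by (auto simp: abs_mult less_imp_le algebra_simps intro: order_trans[OF _ abs_ge_self])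
    qed (auto simp: set_borel_measurable_def)
  qed (intro eq_refl arg_cong[where f = abs] flux_const[symmetric])
  then have "w x * (u x - v x) = 0" for x
    unfolding flux_const[of x] by (simp only: abs_le_zero_iff)
  then have uv: "u x = v x" for x
    using w0[of x] by (metis eq_iff_diff_eq_0 less_irrefl mult_eq_0_iff)
  have u_odd: "u (- x) = - u x" for x
    using uv[of x] unfolding v_def by linarith
  have u0: "u 0 = 0"
    using u_odd[of 0] by simp

  have u_sign: "(\<forall>x\<ge>0. u x \<le> 0) \<or> (\<forall>x\<ge>0. 0 \<le> u x)"
    using assms(8)
  proof
    assume mono: "mono_on {..0} f"
    have "antimono_on {0..} f"
    proof (rule monotone_onI)
      fix x y :: real assume "x \<in> {0..}" "y \<in> {0..}" "x \<le> y"
      then show "f y \<le> f x"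
        using monotone_onD[OF mono, of "- y" "- x"] by (simp add: f_even)
    qed
    then show ?thesis
      using flux_nonpos_if_source_antimono[OF w0 w_int wu energy_u u0] by blast
  next
    assume anti: "antimono_on {..0} f"
    have "antimono_on {0..} (\<lambda>x. - f x)"
    proof (rule monotone_onI)
      fix x y :: real assume "x \<in> {0..}" "y \<in> {0..}" "x \<le> y"
      then show "- f y \<le> - f x"
        using monotone_onD[OF anti, of "- y" "- x"] by (simp add: f_even)
    qed
    \<comment> \<open>The flux equation is linear, so changing the signs of both \<open>u\<close>
      and \<open>f\<close> reduces this case to the other one.\<close>
    then have "- u x \<le> 0" if "0 \<le> x" for x
      using that DERIV_minus[OF wu] energy_u u0
      by (intro flux_nonpos_if_source_antimono[of w "\<lambda>x. - u x" "\<lambda>x. - f x"] w0 w_int) auto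
    then show ?thesis by auto
  qed

  have "integrable lborel (\<lambda>x. w x * (u x)\<^sup>2)"
    by (rule integrable_if_even_half_line[OF energy_u]) (simp add: w_even u_odd)
  then have "integrable lborel (\<lambda>x. w x * (u x)\<^sup>2 + w x)"
    by (intro Bochner_Integration.integrable_add w_int)
  \<comment> \<open>The finite mass of \<open>w\<close> lets square integrability of
    \<open>u\<close> imply integrability.\<close>
  then have "integrable lborel (\<lambda>x. w x * u x)"
  proof (rule Bochner_Integration.integrable_bound)
    have "\<bar>u x\<bar> \<le> (u x)\<^sup>2 + 1" for x
      using zero_le_power2[of "\<bar>u x\<bar> - 1"] by (simp add: power2_diff)
    from mult_left_mono[OF this less_imp_le[OF w0]]
    show "AE x in lborel. norm (w x * u x) \<le> norm (w x * (u x)\<^sup>2 + w x)"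
      using w0 by (auto simp: abs_mult less_imp_le algebra_simps intro: order_trans[OF _ abs_ge_self])
  qed simp
  then have u_gibbs: "integrable (gibbs V) u"
    by (subst gibbs_iff) auto

  have "integrable (gibbs V) (\<lambda>_. 1 :: real)"
    using w_int by (subst gibbs_iff) auto
  then have "finite_measure (gibbs V)"
    by (intro finite_measureI) (auto simp: integrable_iff_bounded)
  then have sf: "sigma_finite_measure (gibbs V)"
    by (rule finite_measure.axioms)
  have sets: "sets (gibbs V) = sets borel"
    by (simp add: gibbs_def)
  have sets2: "sets (indep_coupling V) = sets (borel :: (real \<times> real) measure)"
    using sets_pair_measure_cong[OF sets sets] unfolding indep_coupling_def borel_prod .
  have \<Gamma>: "Gamma_op \<alpha> (xi \<phi>) (x, y) = 1 / 2 * \<alpha> (x, y) * (u x * u y)" for \<alpha> x y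
    unfolding u_def using assms(10) by (intro Gamma_op_xi) auto
  have u_prod: "integrable (indep_coupling V) (\<lambda>(x, y). u x * u y)"
    unfolding indep_coupling_def by (rule integrable_pair_mult[OF sf sf u_gibbs u_gibbs])
  \<comment> \<open>Since \<open>\<bar>\<alpha> / 2\<bar> \<le> 1\<close>, the product
    \<open>u x * u y\<close> dominates the integrand for every admissible control.\<close>
  have \<Gamma>_int: "integrable (indep_coupling V) (Gamma_op \<alpha> (xi \<phi>))" if \<alpha>: "\<alpha> \<in> admissible" for \<alpha>
  proof (rule Bochner_Integration.integrable_bound[OF u_prod])
    have [measurable]: "\<alpha> \<in> borel_measurable (indep_coupling V)"
      "(\<lambda>(x, y). u x * u y) \<in> borel_measurable (indep_coupling V)"
      using \<alpha> u_prod by (auto simp: admissible_def measurable_cong_sets[OF sets2 refl])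
    have "Gamma_op \<alpha> (xi \<phi>) = (\<lambda>p. 1 / 2 * \<alpha> p * (case p of (x, y) \<Rightarrow> u x * u y))"
      by (auto simp: fun_eq_iff \<Gamma>)
    then show "Gamma_op \<alpha> (xi \<phi>) \<in> borel_measurable (indep_coupling V)"
      by simp
    have half: "\<bar>1 / 2 * \<alpha> p\<bar> \<le> 1" for p
      using admissible_bounds[OF \<alpha>, of p] by linarith
    have "\<bar>Gamma_op \<alpha> (xi \<phi>) (x, y)\<bar> \<le> \<bar>u x * u y\<bar>" for x y
      using mult_right_mono[OF half abs_ge_zero, of "(x, y)" "u x * u y"]
      unfolding \<Gamma> abs_mult by simp
    then show "AE p in indep_coupling V. norm (Gamma_op \<alpha> (xi \<phi>) p)
        \<le> norm (case p of (x, y) \<Rightarrow> u x * u y)"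
      by (intro AE_I2) (simp split: prod.split)
  qed
  \<comment> \<open>Oddness carries the fixed sign on \<open>{0..}\<close> to the other half-line,
    so \<open>u x * u y\<close> follows the sign of \<open>x * y\<close> whichever sign holds; on
    the axes it is \<open>0\<close>.\<close>
  have u_le0: "u x * u y \<le> 0" if "x * y \<le> 0" for x y
    using that u_sign u_odd[of x] u_odd[of y] u0
    by (smt (verit) mult_le_0_iff)
  have u_ge0: "0 \<le> u x * u y" if "0 < x * y" for x y
    using that u_sign u_odd[of x] u_odd[of y]
    by (smt (verit) zero_less_mult_iff zero_le_mult_iff)
  show ?thesis
  proof
    fix \<alpha> assume \<alpha>: "\<alpha> \<in> admissible"
    note bnd = admissible_bounds[OF \<alpha>]
    \<comment> \<open>At each point the integrand is linear in the control, and
      \<open>alpha_star\<close> picks the minimising endpoint of the interval from \<open>-1\<close>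
      to \<open>1\<close>.\<close>
    have "Gamma_op alpha_star (xi \<phi>) (x, y) \<le> Gamma_op \<alpha> (xi \<phi>) (x, y)" for x y
    proof (cases "x * y \<le> 0")
      case True
      then show ?thesis
        using mult_right_mono_neg[OF bnd(2) u_le0, of x y "(x, y)"] by (simp add: \<Gamma> alpha_star_def)
    next
      case False
      then show ?thesis
        using mult_right_mono[OF bnd(1) u_ge0, of x y "(x, y)"] by (simp add: \<Gamma> alpha_star_def)
    qed
    then show "delta_sigma2 V \<phi> (Gamma_op alpha_star) \<le> delta_sigma2 V \<phi> (Gamma_op \<alpha>)"
      unfolding delta_sigma2_def
      by (intro integral_mono \<Gamma>_int \<alpha> alpha_star_admissible) auto
  qed
qed

end
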